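(* For $n\in\mathbb N$ and $m\in\mathbb Z$, let $\lambda_{n,m}$ and $\psi_{n,m}$ be the eigenvalues and (normalized) eigenfunction profiles of $A$, and for $\delta\in\mathbb C$ with $|\delta|\le c$ let $\lambda_{n,m}^\delta$ and $\psi_{n,m}^\delta$ be the eigenvalues and (normalized) eigenfunction profiles of $T_\delta$, all as specified in the context. Then for any $n\in\mathbb N$ the sequence $\{\lambda_{n,m}^\delta\}_{m\in\mathbb Z}$ can be arranged in such a way that for every $m\in\mathbb Z$ $$\lim_{\delta\to0}\big|\lambda_{n,m}^\delta-\lambda_{n,m}\big|=0\qquad\text{and}\qquad \lim_{\delta\to0}\big\|\psi_{n,m}^\delta-\psi_{n,m}\big\|_{L^\infty(\Omega)}=0,$$ where $\psi_{n,m}$ and $\psi^\delta_{n,m}$ are regarded as functions of $(x,y)\in\Omega$ that depend only on $x$.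
   Context: Let $\Omega_+=(0,1)\times(0,1)$, $\Omega_-=(-1,0)\times(0,1)$, $\Omega=(-1,1)\times(0,1)$, and $\mathbb N=\{1,2,\dots\}$. The quotients $\frac{\tanh\sqrt z}{\sqrt z}$ and $\frac{\tan\sqrt z}{\sqrt z}$ do not depend on the choice of the square root. The operator $A$: this is the selfadjoint realization in $L^2(\Omega)$ of $f\mapsto(-\Delta f_+,\Delta f_-)^\top$ (with $f_\pm=f|_{\Omega_\pm}$) with Dirichlet condition on $\partial\Omega$ and, on the interface $\mathcal C=\{0\}\times(0,1)$, the conditions $f_+=f_-$ and $\partial_{{\bf n}_+}f_+=\partial_{{\bf n}_-}f_-$ (normals outward from $\Omega_\pm$, traces in a suitable generalized sense). For each $n\in\mathbb N$, $\{\lambda_{n,m}\}_{m\in\mathbb Z}$ is the increasing sequence of the (simple) real roots $\lambda\ne\pm(n\pi)^2$ of $$\frac{\tanh\sqrt{\lambda+(n\pi)^2}}{\sqrt{\lambda+(n\pi)^2}}=\frac{\tan\sqrt{\lambda-(n\pi)^2}}{\sqrt{\lambda-(n\pi)^2}},$$ indexed so that $\lambda_{n,0}=0$. These are eigenvalues of $A$, with eigenfunctions $\psi_{n,m}(x)\sqrt2\sin(n\pi y)$, where $$\psi_{n,m}(x)=\begin{cases}N_{n,m}\sinh\sqrt{\lambda_{n,m}+(n\pi)^2}\,\sin\big(\sqrt{\lambda_{n,m}-(n\pi)^2}\,(1-x)\big),&x>0,\\ N_{n,m}\sin\sqrt{\lambda_{n,m}-(n\pi)^2}\,\sinh\big(\sqrt{\lambda_{n,m}+(n\pi)^2}\,(1+x)\big),&x<0,\end{cases}$$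 and $N_{n,m}\in\mathbb C\setminus\{0\}$ is chosen such that $\psi_{n,m}$ has norm $1$ in $L^2((-1,1))$ (this fixes $|N_{n,m}|$). The operator $T_\delta$: for $\delta\in\mathbb C$, $|\delta|<1$, let $a_\delta=1$ on $\Omega_+$ and $a_\delta=-\frac1{1+\delta}$ on $\Omega_-$, and let $T_\delta f=-\operatorname{div}(a_\delta\nabla f)$ with $\operatorname{dom}T_\delta=\{f\in H^1_0(\Omega):\operatorname{div}(a_\delta\nabla f)\in L^2(\Omega)\}$. There is an absolute constant $c>0$ (fixed here, $c<1$) such that for $|\delta|\le c$ the point spectrum of $T_\delta$ is $\bigcup_{n\in\mathbb N}\bigcup_{m\in\mathbb Z}\{\lambda_{n,m}^\delta\}$, where for each $n$, $\{\lambda_{n,m}^\delta\}_{m\in\mathbb Z}$ is a sequence of the complex roots $\lambda\neq(n\pi)^2,\ \lambda\ne-(n\pi)^2/(1+\delta)$ of $$(1+\delta)\frac{\tanh\sqrt{(1+\delta)\lambda+(n\pi)^2}}{\sqrt{(1+\delta)\lambda+(n\pi)^2}}=\frac{\tan\sqrt{\lambda-(n\pi)^2}}{\sqrt{\lambda-(n\pi)^2}}.$$ The corresponding eigenfunctions are $\psi_{n,m}^\delta(x)\sqrt2\sin(n\pi y)$ with $$\psi_{n,m}^\delta(x)=\begin{cases}N_{n,m}^\delta\sinh\sqrt{(1+\delta)\lambda_{n,m}^\delta+(n\pi)^2}\,\sin\big(\sqrt{\lambda_{n,m}^\delta-(n\pi)^2}\,(1-x)\big),&x>0,\\ N_{n,m}^\delta\sin\sqrt{\lambda_{n,m}^\delta-(n\pi)^2}\,\sinh\big(\sqrt{(1+\delta)\lambda_{n,m}^\delta+(n\pi)^2}\,(1+x)\big),&x<0,\end{cases}$$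 where $N_{n,m}^\delta\in\mathbb C\setminus\{0\}$ is chosen such that $\psi_{n,m}^\delta$ has norm $1$ in $L^2((-1,1))$ (this fixes $|N_{n,m}^\delta|$). *)

theory Defs
  imports "HOL-Probability.Probability"
begin

section \<open>Function spaces on the rectangle\<close>

definition Omega_plus :: "(real \<times> real) set" where
  "Omega_plus = {0<..<1} \<times> {0<..<1}"

definition Omega_minus :: "(real \<times> real) set" where
  "Omega_minus = {-1<..<0} \<times> {0<..<1}"

definition Omega :: "(real \<times> real) set" where
  "Omega = {-1<..<1} \<times> {0<..<1}"

definition L2_space :: "'a::euclidean_space set \<Rightarrow> ('a \<Rightarrow> complex) set" where
  "L2_space S = {f \<in> borel_measurable (lebesgue_on S).
     integrable (lebesgue_on S) (\<lambda>x. (cmod (f x))\<^sup>2)}"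

text \<open>Both norms are meant for measurable functions only. The integral of a function that is not
  integrable is 0, so \<open>L2_norm\<close> is meaningful on \<open>L2_space\<close> only; \<open>L2_norm S f = 1\<close>
  does imply that the square of the modulus is integrable.\<close>

definition L2_norm :: "'a::euclidean_space set \<Rightarrow> ('a \<Rightarrow> complex) \<Rightarrow> real" where
  "L2_norm S f = sqrt (LINT x|lebesgue_on S. (cmod (f x))\<^sup>2)"

definition Linf_norm :: "'a::euclidean_space set \<Rightarrow> ('a \<Rightarrow> complex) \<Rightarrow> ereal" where
  "Linf_norm S f = esssup (lebesgue_on S) (\<lambda>x. ereal (cmod (f x)))"

definition partial_x :: "(real \<times> real \<Rightarrow> complex) \<Rightarrow> real \<times> real \<Rightarrow> complex" where
  "partial_x f p = vector_derivative (\<lambda>t. f (t, snd p)) (at (fst p))"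

definition partial_y :: "(real \<times> real \<Rightarrow> complex) \<Rightarrow> real \<times> real \<Rightarrow> complex" where
  "partial_y f p = vector_derivative (\<lambda>t. f (fst p, t)) (at (snd p))"

primrec C_k :: "nat \<Rightarrow> (real \<times> real \<Rightarrow> complex) \<Rightarrow> bool" where
  "C_k 0 f \<longleftrightarrow> continuous_on UNIV f"
| "C_k (Suc k) f \<longleftrightarrow> (\<forall>p. f differentiable (at p)) \<and> C_k k (partial_x f) \<and> C_k k (partial_y f)"

text \<open>The smooth functions with compact support in \<open>S\<close>, extended by 0 to the whole plane.\<close>

definition test_functions :: "(real \<times> real) set \<Rightarrow> (real \<times> real \<Rightarrow> complex) set" where
  "test_functions S = {\<phi>. (\<forall>k. C_k k \<phi>) \<and>
     compact (closure {p. \<phi> p \<noteq> 0}) \<and> closure {p. \<phi> p \<noteq> 0} \<subseteq> S}"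

text \<open>\<open>H10_with_gradient S f g1 g2\<close>: the function \<open>f\<close> belongs to the closure of the test functions
  in the Sobolev space of order one over \<open>S\<close>, and its weak gradient is \<open>(g1, g2)\<close>.\<close>

definition H10_with_gradient ::
    "(real \<times> real) set \<Rightarrow> (real \<times> real \<Rightarrow> complex) \<Rightarrow>
     (real \<times> real \<Rightarrow> complex) \<Rightarrow> (real \<times> real \<Rightarrow> complex) \<Rightarrow> bool" where
  "H10_with_gradient S f g1 g2 \<longleftrightarrow>
     f \<in> L2_space S \<and> g1 \<in> L2_space S \<and> g2 \<in> L2_space S \<and>
     (\<exists>\<phi> :: nat \<Rightarrow> real \<times> real \<Rightarrow> complex. (\<forall>k. \<phi> k \<in> test_functions S) \<and>
        (\<lambda>k. L2_norm S (\<lambda>p. \<phi> k p - f p)) \<longlonglongrightarrow> 0 \<and>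
        (\<lambda>k. L2_norm S (\<lambda>p. partial_x (\<phi> k) p - g1 p)) \<longlonglongrightarrow> 0 \<and>
        (\<lambda>k. L2_norm S (\<lambda>p. partial_y (\<phi> k) p - g2 p)) \<longlonglongrightarrow> 0)"

section \<open>The operator \<open>T_\<delta>\<close>\<close>

text \<open>The value on the interface (a null set) is irrelevant.\<close>

definition a_coeff :: "complex \<Rightarrow> real \<times> real \<Rightarrow> complex" where
  "a_coeff \<delta> p = (if p \<in> Omega_plus then 1 else if p \<in> Omega_minus then - (1 / (1 + \<delta>)) else 0)"

text \<open>The graph of the operator: \<open>f\<close> lies in its domain and is mapped to \<open>h\<close>, where
  \<open>- div (a \<nabla>f) = h\<close> is understood in the sense of distributions on \<open>Omega\<close>.\<close>

definition T_graph ::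
    "complex \<Rightarrow> (real \<times> real \<Rightarrow> complex) \<Rightarrow> (real \<times> real \<Rightarrow> complex) \<Rightarrow> bool" where
  "T_graph \<delta> f h \<longleftrightarrow> h \<in> L2_space Omega \<and>
     (\<exists>g1 g2. H10_with_gradient Omega f g1 g2 \<and>
        (\<forall>\<phi> \<in> test_functions Omega.
           (LINT p|lebesgue_on Omega.
              a_coeff \<delta> p * (g1 p * partial_x \<phi> p + g2 p * partial_y \<phi> p)) =
           (LINT p|lebesgue_on Omega. h p * \<phi> p)))"

definition T_point_spectrum :: "complex \<Rightarrow> complex set" where
  "T_point_spectrum \<delta> =
     {\<mu>. \<exists>f. T_graph \<delta> f (\<lambda>p. \<mu> * f p) \<and> \<not> (AE p in lebesgue_on Omega. f p = 0)}"

section \<open>The characteristic equations\<close>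

text \<open>The quotients do not depend on the choice of the square root, so the principal one is used.\<close>

definition tanh_quot :: "complex \<Rightarrow> complex" where
  "tanh_quot z = tanh (csqrt z) / csqrt z"

definition tan_quot :: "complex \<Rightarrow> complex" where
  "tan_quot z = tan (csqrt z) / csqrt z"

text \<open>Division by zero yields 0 in HOL, so a root is explicitly required not to be a pole of one of
  the two quotients. The singularities of the quotients at 0 are the values of \<open>\<lambda>\<close> that are
  excluded.\<close>

definition quots_defined :: "complex \<Rightarrow> complex \<Rightarrow> bool" where
  "quots_defined z w \<longleftrightarrow> cosh (csqrt z) \<noteq> 0 \<and> cos (csqrt w) \<noteq> 0"

definition A_roots :: "nat \<Rightarrow> real set" where
  "A_roots n = {l. l \<noteq> (n * pi)\<^sup>2 \<and> l \<noteq> - (n * pi)\<^sup>2 \<and>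
     quots_defined (of_real (l + (n * pi)\<^sup>2)) (of_real (l - (n * pi)\<^sup>2)) \<and>
     tanh_quot (of_real (l + (n * pi)\<^sup>2)) = tan_quot (of_real (l - (n * pi)\<^sup>2))}"

definition T_roots :: "complex \<Rightarrow> nat \<Rightarrow> complex set" where
  "T_roots \<delta> n = {l. l \<noteq> of_real ((n * pi)\<^sup>2) \<and> l \<noteq> - (of_real ((n * pi)\<^sup>2) / (1 + \<delta>)) \<and>
     quots_defined ((1 + \<delta>) * l + of_real ((n * pi)\<^sup>2)) (l - of_real ((n * pi)\<^sup>2)) \<and>
     (1 + \<delta>) * tanh_quot ((1 + \<delta>) * l + of_real ((n * pi)\<^sup>2)) =
       tan_quot (l - of_real ((n * pi)\<^sup>2))}"

section \<open>Eigenfunction profiles\<close>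

text \<open>Another choice of the square roots changes the profile by a sign only, which can be absorbed
  in the constant \<open>N\<close>.\<close>

definition profile :: "complex \<Rightarrow> complex \<Rightarrow> complex \<Rightarrow> real \<Rightarrow> complex" where
  "profile N z w x =
     (if x > 0 then N * sinh (csqrt z) * sin (csqrt w * of_real (1 - x))
      else N * sin (csqrt w) * sinh (csqrt z * of_real (1 + x)))"

definition A_profile :: "nat \<Rightarrow> real \<Rightarrow> complex \<Rightarrow> real \<Rightarrow> complex" where
  "A_profile n l N = profile N (of_real (l + (n * pi)\<^sup>2)) (of_real (l - (n * pi)\<^sup>2))"

definition T_profile :: "complex \<Rightarrow> nat \<Rightarrow> complex \<Rightarrow> complex \<Rightarrow> real \<Rightarrow> complex" where
  "T_profile \<delta> n l N =
     profile N ((1 + \<delta>) * l + of_real ((n * pi)\<^sup>2)) (l - of_real ((n * pi)\<^sup>2))"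

end

theory Submission
  imports Defs "HOL-Complex_Analysis.Great_Picard"
begin

text \<open>For fixed \<open>n\<close>, the characteristic equations at \<open>\<delta>\<close> and at 0 are, after clearing denominators and
near a given root \<open>l0\<close> of the unperturbed equation, equations \<open>F (\<delta>, \<mu>) = 0\<close> and \<open>F (0, \<mu>) = 0\<close> with
\<open>F\<close> continuous, and holomorphic in \<open>\<mu>\<close>. The roots \<open>lam n m\<close> form an increasing sequence indexed by the
integers, so \<open>F (0, \<cdot>)\<close> does not vanish identically near any of them, and Hurwitz's theorem provides,
for small \<open>\<delta>\<close>, roots of the perturbed equation as close to \<open>lam n m\<close> as desired
(\<open>T_root_near_A_root\<close>).

How small \<open>\<delta>\<close> must be depends on \<open>m\<close>, while an arrangement of the perturbed roots is a bijection of all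
indices for each single \<open>\<delta>\<close>. This is no obstacle, because the limits are only required for each \<open>m\<close>
separately: for a given \<open>\<delta>\<close> it is enough to place correctly finitely many roots, a number that grows as
\<open>\<delta>\<close> tends to 0, and an injection of a finite set of integers extends to a bijection
(\<open>rearrangement_converges\<close>).

For the profiles, scale each to be 1 at the interface \<open>x = 0\<close>. This is possible because no profile
that belongs to a root vanishes there (\<open>T_root_nonresonant\<close>, which uses \<open>Re (1 + \<delta>) > 0\<close>). The scaled profile is
jointly continuous in \<open>x\<close> and in the two square roots and is even in the latter; division by the \<open>L\<^sup>2\<close>
norm preserves this. Compactness of \<open>[-1, 1]\<close> then turns convergence of the roots into uniform
convergence of the normalized profiles, once the phase of the normalizing constant is chosen to agree
with that of \<open>N n m\<close> (\<open>profile_difference_tendsto\<close>).\<close>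

section \<open>Branches of the square root\<close>

text \<open>For \<open>z0 \<noteq> 0\<close> this is the branch of the square root that is holomorphic on the half plane
\<open>Re (z / z0) > 0\<close> and agrees with the principal branch at \<open>z0\<close>. At a real
root \<open>l < (n\<pi>)\<^sup>2\<close>, such as 0, the argument \<open>l - (n\<pi>)\<^sup>2\<close> of the characteristic equation lies on the
cut of the principal branch.\<close>

definition sqrt_branch :: "complex \<Rightarrow> complex \<Rightarrow> complex" where
  "sqrt_branch z0 z = csqrt z0 * csqrt (z / z0)"

lemma sqrt_branch_square:
  assumes "z0 \<noteq> 0"
  shows "(sqrt_branch z0 z)\<^sup>2 = z"
  using assms by (simp add: sqrt_branch_def power_mult_distrib)

lemma sqrt_branch_self:
  assumes "z0 \<noteq> 0"
  shows "sqrt_branch z0 z0 = csqrt z0"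
  using assms by (simp add: sqrt_branch_def)

lemma continuous_on_sqrt_branch:
  assumes "continuous_on S f" "\<And>x. x \<in> S \<Longrightarrow> Re (f x / z0) > 0"
  shows "continuous_on S (\<lambda>x. sqrt_branch z0 (f x))"
proof -
  have "z0 \<noteq> 0" if "x \<in> S" for x
    using assms(2)[OF that] by auto
  then have "continuous_on S (\<lambda>x. f x / z0)"
    using assms(1) by (cases "S = {}") (auto intro!: continuous_intros)
  moreover have "f x / z0 \<notin> \<real>\<^sub>\<le>\<^sub>0" if "x \<in> S" for x
    using assms(2)[OF that] by (auto simp: complex_nonpos_Reals_iff)
  ultimately show ?thesis
    unfolding sqrt_branch_def
    by (intro continuous_on_mult continuous_on_const continuous_on_compose2[OF continuous_on_csqrt]) auto
qed

lemma holomorphic_on_sqrt_branch: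
  assumes "f holomorphic_on S" "\<And>x. x \<in> S \<Longrightarrow> Re (f x / z0) > 0"
  shows "(\<lambda>x. sqrt_branch z0 (f x)) holomorphic_on S"
proof -
  have "z0 \<noteq> 0" if "x \<in> S" for x
    using assms(2)[OF that] by auto
  then have "(\<lambda>x. f x / z0) holomorphic_on S"
    using assms(1) by (cases "S = {}") (auto intro!: holomorphic_intros)
  moreover have "f x / z0 \<notin> \<real>\<^sub>\<le>\<^sub>0" if "x \<in> S" for x
    using assms(2)[OF that] by (auto simp: complex_nonpos_Reals_iff)
  ultimately show ?thesis
    unfolding sqrt_branch_def
    by (intro holomorphic_on_mult holomorphic_on_const holomorphic_on_csqrt')
qed

lemma isCont_sqrt_branch:
  assumes "z0 \<noteq> 0"
  shows "isCont (sqrt_branch z0) z0"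
  unfolding sqrt_branch_def using assms
  by (intro continuous_intros isCont_csqrt') (auto simp: complex_nonpos_Reals_iff)

lemma tendsto_sqrt_branch:
  assumes "(f \<longlongrightarrow> z0) F" "z0 \<noteq> 0"
  shows "((\<lambda>t. sqrt_branch z0 (f t)) \<longlongrightarrow> csqrt z0) F"
  using isCont_tendsto_compose[OF isCont_sqrt_branch[OF assms(2)] assms(1)]
  by (simp add: sqrt_branch_self assms(2))

section \<open>The characteristic equations\<close>

lemma csqrt_cases: "csqrt (p\<^sup>2) = p \<or> csqrt (p\<^sup>2) = - p"
  by (metis power2_csqrt power2_eq_iff)

lemma tanh_quot_square: "tanh_quot (p\<^sup>2) = tanh p / p"
  using csqrt_cases[of p] by (auto simp: tanh_quot_def)

lemma tan_quot_square: "tan_quot (p\<^sup>2) = tan p / p"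
  using csqrt_cases[of p] by (auto simp: tan_quot_def)

lemma quots_defined_square: "quots_defined (p\<^sup>2) (q\<^sup>2) \<longleftrightarrow> cosh p \<noteq> 0 \<and> cos q \<noteq> 0"
  using csqrt_cases[of p] csqrt_cases[of q] by (auto simp: quots_defined_def)

text \<open>Clearing denominators: the left-hand side of the last equation is an entire function of \<open>p\<close>, \<open>q\<close>,
\<open>\<delta>\<close>, and the quotients are even in the square root, so any square roots \<open>p\<close>, \<open>q\<close> will do.\<close>

lemma T_roots_iff:
  assumes p: "p\<^sup>2 = (1 + \<delta>) * l + of_real ((real n * pi)\<^sup>2)"
    and q: "q\<^sup>2 = l - of_real ((real n * pi)\<^sup>2)"
    and "1 + \<delta> \<noteq> 0"
  shows "l \<in> T_roots \<delta> n \<longleftrightarrow> p \<noteq> 0 \<and> q \<noteq> 0 \<and> cosh p \<noteq> 0 \<and> cos q \<noteq> 0 \<and>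
    (1 + \<delta>) * sinh p * cos q * q - sin q * cosh p * p = 0"
proof -
  have "l \<noteq> of_real ((real n * pi)\<^sup>2) \<longleftrightarrow> q \<noteq> 0"
    by (metis q eq_iff_diff_eq_0 zero_eq_power2)
  moreover have "l \<noteq> - (of_real ((real n * pi)\<^sup>2) / (1 + \<delta>)) \<longleftrightarrow> p \<noteq> 0"
  proof -
    have "l = - (of_real ((real n * pi)\<^sup>2) / (1 + \<delta>)) \<longleftrightarrow> p\<^sup>2 = 0"
      unfolding p using \<open>1 + \<delta> \<noteq> 0\<close> by (simp add: field_simps eq_neg_iff_add_eq_0)
    then show ?thesis by simp
  qed
  moreover have "(1 + \<delta>) * (tanh p / p) = tan q / q \<longleftrightarrow>
      (1 + \<delta>) * sinh p * cos q * q - sin q * cosh p * p = 0"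
    if "p \<noteq> 0" "q \<noteq> 0" "cosh p \<noteq> 0" "cos q \<noteq> 0"
    using that by (simp add: tanh_def tan_def field_simps)
  ultimately show ?thesis
    unfolding T_roots_def mem_Collect_eq p[symmetric] q[symmetric]
      tanh_quot_square tan_quot_square quots_defined_square by blast
qed

lemma A_roots_iff_T_roots: "l \<in> A_roots n \<longleftrightarrow> complex_of_real l \<in> T_roots 0 n"
proof -
  have "complex_of_real l = - (of_real ((real n * pi)\<^sup>2) / (1 + 0)) \<longleftrightarrow> l = - (real n * pi)\<^sup>2"
    by (metis div_by_1 add_0_right of_real_eq_iff of_real_minus)
  moreover have "complex_of_real l = of_real ((real n * pi)\<^sup>2) \<longleftrightarrow> l = (real n * pi)\<^sup>2"
    by (rule of_real_eq_iff)
  ultimately show ?thesis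
    unfolding A_roots_def T_roots_def mem_Collect_eq
    by (simp only: add_0_right mult_1 of_real_add of_real_diff)
qed

text \<open>Let \<open>p\<close> and \<open>q\<close> be the two square roots. A profile vanishes identically when \<open>sinh p = 0\<close> and
\<open>sin q = 0\<close>, and then it cannot be normalized. At a root one of these equations implies the other, and together they say that \<open>p\<close> is an
integer multiple of \<open>\<i>\<pi>\<close> and \<open>q\<close> one of \<open>\<pi>\<close>. Then \<open>l\<close> is a positive real while \<open>(1 + \<delta>) l\<close>
is a real number that is at most 0, contrary to \<open>Re (1 + \<delta>) > 0\<close>.\<close>

lemma T_root_nonresonant:
  assumes l: "l \<in> T_roots \<delta> n" and \<delta>: "cmod \<delta> < 1"
  shows "sinh (csqrt ((1 + \<delta>) * l + of_real ((real n * pi)\<^sup>2))) \<noteq> 0"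
    and "sin (csqrt (l - of_real ((real n * pi)\<^sup>2))) \<noteq> 0"
proof -
  define p where "p = csqrt ((1 + \<delta>) * l + of_real ((real n * pi)\<^sup>2))"
  define q where "q = csqrt (l - of_real ((real n * pi)\<^sup>2))"
  have p: "p\<^sup>2 = (1 + \<delta>) * l + of_real ((real n * pi)\<^sup>2)"
    and q: "q\<^sup>2 = l - of_real ((real n * pi)\<^sup>2)"
    by (simp_all add: p_def q_def)
  have Re\<delta>: "1 + Re \<delta> > 0"
    using abs_Re_le_cmod[of \<delta>] \<delta> by linarith
  then have "1 + \<delta> \<noteq> 0"
    by (auto simp: complex_eq_iff)
  then have pq: "p \<noteq> 0" "q \<noteq> 0" "cosh p \<noteq> 0" "cos q \<noteq> 0"
    and eq: "(1 + \<delta>) * sinh p * cos q * q - sin q * cosh p * p = 0"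
    using l T_roots_iff[OF p q] by auto
  have False if "sinh p = 0" "sin q = 0"
  proof -
    obtain i j :: int where i: "q = of_real (of_int i * pi)" and j: "\<i> * p = of_real (of_int j * pi)"
      using \<open>sin q = 0\<close> \<open>sinh p = 0\<close> by (auto simp: sin_eq_0 sinh_conv_sin)
    have "p\<^sup>2 = - ((\<i> * p)\<^sup>2)"
      by (simp add: power_mult_distrib)
    then have "p\<^sup>2 = of_real (- (of_int j * pi)\<^sup>2)"
      unfolding j by simp
    moreover have "l = of_real ((of_int i * pi)\<^sup>2 + (real n * pi)\<^sup>2)"
      using q unfolding i by (simp add: algebra_simps)
    ultimately have "Re ((1 + \<delta>) * of_real ((of_int i * pi)\<^sup>2 + (real n * pi)\<^sup>2)) =
        - (of_int j * pi)\<^sup>2 - (real n * pi)\<^sup>2"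
      using arg_cong[OF p, of Re] by (simp only: Re_complex_of_real plus_complex.simps)
    then have "(1 + Re \<delta>) * ((of_int i * pi)\<^sup>2 + (real n * pi)\<^sup>2) \<le> 0"
      by (simp del: of_real_add)
    moreover have "(of_int i * pi)\<^sup>2 + (real n * pi)\<^sup>2 > 0"
      using i \<open>q \<noteq> 0\<close> by (intro add_pos_nonneg) auto
    ultimately show False
      using Re\<delta> by (meson mult_pos_pos not_le)
  qed
  then have "sinh p \<noteq> 0 \<and> sin q \<noteq> 0"
    using eq pq \<open>1 + \<delta> \<noteq> 0\<close> by auto
  then show "sinh (csqrt ((1 + \<delta>) * l + of_real ((real n * pi)\<^sup>2))) \<noteq> 0"
    "sin (csqrt (l - of_real ((real n * pi)\<^sup>2))) \<noteq> 0"
    unfolding p_def q_def by blast+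
qed

section \<open>Persistence of roots\<close>

text \<open>This is Hurwitz's theorem. Near \<open>(0, l0)\<close> the perturbed roots are the zeros of a function \<open>F (\<delta>, \<mu>)\<close>
that is continuous in both variables and holomorphic in \<open>\<mu>\<close>. If for a sequence \<open>\<delta>\<^sub>j \<longlongrightarrow> 0\<close> there
were no root near \<open>l0\<close>, then the zero-free functions \<open>F (\<delta>\<^sub>j, \<cdot>)\<close> would converge locally uniformly to
\<open>F (0, \<cdot>)\<close>, which vanishes at \<open>l0\<close>; so \<open>F (0, \<cdot>)\<close> would be constant, hence zero, near \<open>l0\<close>, and
\<open>l0\<close> would not be an isolated root.\<close>

lemma T_root_near_A_root:
  assumes l0: "l0 \<in> A_roots n"
    and iso: "\<And>e. e > 0 \<Longrightarrow> \<exists>l. \<bar>l - l0\<bar> < e \<and> l \<notin> A_roots n"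
    and "\<epsilon> > 0"
  shows "\<exists>\<eta>>0. \<forall>\<delta>. cmod \<delta> < \<eta> \<longrightarrow> (\<exists>l\<in>T_roots \<delta> n. cmod (l - of_real l0) < \<epsilon>)"
proof -
  define k where "k = complex_of_real ((real n * pi)\<^sup>2)"
  define z where "z = (\<lambda>d :: complex \<times> complex. (1 + fst d) * snd d + k)"
  define w where "w = (\<lambda>d :: complex \<times> complex. snd d - k)"
  define d0 where "d0 = (0 :: complex, complex_of_real l0)"
  define P where "P = (\<lambda>d. sqrt_branch (z d0) (z d))"
  define Q where "Q = (\<lambda>d. sqrt_branch (w d0) (w d))"
  define F where "F = (\<lambda>d. (1 + fst d) * sinh (P d) * cos (Q d) * Q d - sin (Q d) * cosh (P d) * P d)"
  have root0: "complex_of_real l0 \<in> T_roots 0 n"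
    using l0 by (simp add: A_roots_iff_T_roots)
  have base: "csqrt (z d0) \<noteq> 0 \<and> csqrt (w d0) \<noteq> 0 \<and> cosh (csqrt (z d0)) \<noteq> 0 \<and> cos (csqrt (w d0)) \<noteq> 0"
    using root0 T_roots_iff[of "csqrt (z d0)" 0 "of_real l0" n "csqrt (w d0)"]
    by (simp add: z_def w_def d0_def k_def)
  then have nz: "z d0 \<noteq> 0" "w d0 \<noteq> 0"
    by auto
  have P2: "(P d)\<^sup>2 = (1 + fst d) * snd d + k" and Q2: "(Q d)\<^sup>2 = snd d - k" for d
    using nz by (simp_all add: P_def Q_def sqrt_branch_square z_def w_def)
  have contz: "isCont z d" and contw: "isCont w d" for d
    unfolding z_def w_def by (intro continuous_intros)+
  have limz: "(z \<longlongrightarrow> z d0) (nhds d0)" and limw: "(w \<longlongrightarrow> w d0) (nhds d0)"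
    using contz[of d0] contw[of d0] by (simp_all only: isCont_def tendsto_at_iff_tendsto_nhds)
  have Plim: "(P \<longlongrightarrow> csqrt (z d0)) (nhds d0)" and Qlim: "(Q \<longlongrightarrow> csqrt (w d0)) (nhds d0)"
    unfolding P_def Q_def using limz limw nz by (auto intro!: tendsto_sqrt_branch)
  \<comment> \<open>Where it holds, the branches are holomorphic and no denominator vanishes.\<close>
  define good where "good = (\<lambda>d. Re (z d / z d0) > 0 \<and> Re (w d / w d0) > 0 \<and>
     cosh (P d) \<noteq> 0 \<and> cos (Q d) \<noteq> 0 \<and> 1 + fst d \<noteq> 0)"
  have "\<forall>\<^sub>F d in nhds d0. good d"
  proof -
    have "((\<lambda>d. Re (z d / z d0)) \<longlongrightarrow> Re (z d0 / z d0)) (nhds d0)"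
      "((\<lambda>d. Re (w d / w d0)) \<longlongrightarrow> Re (w d0 / w d0)) (nhds d0)"
      by (intro tendsto_intros limz limw nz)+
    then have "\<forall>\<^sub>F d in nhds d0. Re (z d / z d0) > 0" "\<forall>\<^sub>F d in nhds d0. Re (w d / w d0) > 0"
      using nz by (auto intro: order_tendstoD)
    moreover have "\<forall>\<^sub>F d in nhds d0. cosh (P d) \<noteq> 0"
      using tendsto_cosh[OF Plim] base by (intro tendsto_imp_eventually_ne) auto
    moreover have "\<forall>\<^sub>F d in nhds d0. cos (Q d) \<noteq> 0"
      using tendsto_cos[OF Qlim] base by (intro tendsto_imp_eventually_ne) auto
    moreover have "((\<lambda>d. 1 + fst d) \<longlongrightarrow> 1 + fst d0) (nhds d0)"
      by (intro tendsto_intros filterlim_ident)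
    then have "\<forall>\<^sub>F d in nhds d0. 1 + fst d \<noteq> 0"
      by (rule tendsto_imp_eventually_ne) (simp add: d0_def)
    ultimately show ?thesis
      unfolding good_def by eventually_elim auto
  qed
  then obtain s where s: "s > 0" "\<And>d. dist d d0 < s \<Longrightarrow> good d"
    by (auto simp: eventually_nhds_metric)
  \<comment> \<open>The distance in the product is at most the sum of the distances of the two components.\<close>
  define r where "r = min (s / 2) \<epsilon>"
  have r: "r > 0" "r \<le> \<epsilon>"
    using s \<open>\<epsilon> > 0\<close> by (auto simp: r_def)
  have good: "good d" if "d \<in> ball 0 r \<times> ball (of_real l0) r" for d
  proof -
    have "dist d d0 \<le> dist (fst d) (fst d0) + dist (snd d) (snd d0)"
      using sqrt_sum_squares_le_sum[of "dist (fst d) (fst d0)" "dist (snd d) (snd d0)"]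
      by (simp add: dist_prod_def)
    also have "\<dots> < s"
      using that by (cases d) (auto simp: d0_def r_def dist_commute)
    finally show ?thesis by (rule s(2))
  qed
  \<comment> \<open>The excluded values of \<open>\<lambda>\<close> and the poles stay outside the bidisc, so only \<open>F = 0\<close> remains.\<close>
  have roots: "\<mu> \<in> T_roots \<delta> n \<longleftrightarrow> F (\<delta>, \<mu>) = 0" if "cmod \<delta> < r" "\<mu> \<in> ball (of_real l0) r" for \<delta> \<mu>
  proof -
    have g: "good (\<delta>, \<mu>)"
      using that by (intro good) auto
    then have "z (\<delta>, \<mu>) \<noteq> 0" "w (\<delta>, \<mu>) \<noteq> 0"
      by (auto simp: good_def)
    then have "P (\<delta>, \<mu>) \<noteq> 0" "Q (\<delta>, \<mu>) \<noteq> 0"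
      using P2[of "(\<delta>, \<mu>)"] Q2[of "(\<delta>, \<mu>)"] by (auto simp: z_def w_def)
    then show ?thesis
      using T_roots_iff[of "P (\<delta>, \<mu>)" \<delta> \<mu> n "Q (\<delta>, \<mu>)"] P2[of "(\<delta>, \<mu>)"] Q2[of "(\<delta>, \<mu>)"] g
      by (auto simp: k_def good_def F_def)
  qed
  have Fcont: "continuous_on (ball 0 r \<times> ball (of_real l0) r) F"
  proof -
    have "continuous_on X z" "continuous_on X w" for X
      by (auto intro!: continuous_at_imp_continuous_on contz contw)
    then have "continuous_on (ball 0 r \<times> ball (of_real l0) r) P"
      "continuous_on (ball 0 r \<times> ball (of_real l0) r) Q"
      unfolding P_def Q_def using good
      by (intro continuous_on_sqrt_branch; force simp: good_def)+
    then show ?thesis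
      unfolding F_def by (intro continuous_intros)
  qed
  have Fhol: "(\<lambda>\<mu>. F (\<delta>, \<mu>)) holomorphic_on ball (of_real l0) r" if "cmod \<delta> < r" for \<delta>
  proof -
    have "(\<lambda>\<mu>. P (\<delta>, \<mu>)) holomorphic_on ball (of_real l0) r"
      unfolding P_def
    proof (rule holomorphic_on_sqrt_branch)
      show "(\<lambda>\<mu>. z (\<delta>, \<mu>)) holomorphic_on ball (of_real l0) r"
        unfolding z_def by (simp, intro holomorphic_intros)
    qed (use good that in \<open>auto simp: good_def\<close>)
    moreover have "(\<lambda>\<mu>. Q (\<delta>, \<mu>)) holomorphic_on ball (of_real l0) r"
      unfolding Q_def
    proof (rule holomorphic_on_sqrt_branch)
      show "(\<lambda>\<mu>. w (\<delta>, \<mu>)) holomorphic_on ball (of_real l0) r"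
        unfolding w_def by (simp, intro holomorphic_intros)
    qed (use good that in \<open>auto simp: good_def\<close>)
    ultimately show ?thesis
      unfolding F_def sinh_field_def cosh_field_def fst_conv by (intro holomorphic_intros) auto
  qed
  show ?thesis
  proof (rule ccontr)
    assume *: "\<not> ?thesis"
    have "\<exists>\<delta>. cmod \<delta> < min r (inverse (Suc j)) \<and> (\<forall>\<mu>\<in>T_roots \<delta> n. \<not> cmod (\<mu> - of_real l0) < \<epsilon>)" for j
    proof -
      have "min r (inverse (Suc j)) > 0"
        using r by simp
      then show ?thesis
        using * by blast
    qed
    then obtain \<delta> where \<delta>: "\<And>j. cmod (\<delta> j) < min r (inverse (Suc j))"
      and no: "\<And>j \<mu>. \<mu> \<in> T_roots (\<delta> j) n \<Longrightarrow> \<not> cmod (\<mu> - of_real l0) < \<epsilon>"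
      by metis
    have \<delta>r: "cmod (\<delta> j) < r" for j
      using \<delta>[of j] by simp
    have \<delta>0: "\<delta> \<longlonglongrightarrow> 0"
    proof (rule tendsto_norm_zero_cancel, rule tendsto_sandwich)
      show "\<forall>\<^sub>F j in sequentially. 0 \<le> cmod (\<delta> j)"
        by simp
      show "\<forall>\<^sub>F j in sequentially. cmod (\<delta> j) \<le> inverse (Suc j)"
        using \<delta> by (intro always_eventually allI) (simp add: less_imp_le)
      show "(\<lambda>j. inverse (real (Suc j))) \<longlonglongrightarrow> 0"
        by (rule LIMSEQ_inverse_real_of_nat)
    qed simp
    have "F (0, of_real l0) \<noteq> 0"
    proof (rule Hurwitz_no_zeros[of "ball (of_real l0) r" "\<lambda>j \<mu>. F (\<delta> j, \<mu>)" "\<lambda>\<mu>. F (0, \<mu>)"])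
      show "(\<lambda>\<mu>. F (\<delta> j, \<mu>)) holomorphic_on ball (of_real l0) r" for j
        by (rule Fhol[OF \<delta>r])
      show "(\<lambda>\<mu>. F (0, \<mu>)) holomorphic_on ball (of_real l0) r"
        by (rule Fhol) (simp add: r)
      show "F (\<delta> j, \<mu>) \<noteq> 0" if "\<mu> \<in> ball (of_real l0) r" for j \<mu>
        using no[of \<mu> j] roots[OF \<delta>r that] that r by (auto simp: dist_norm norm_minus_commute)
      show "\<not> (\<lambda>\<mu>. F (0, \<mu>)) constant_on ball (of_real l0) r"
      proof
        assume "(\<lambda>\<mu>. F (0, \<mu>)) constant_on ball (of_real l0) r"
        then obtain c where c: "\<And>\<mu>. \<mu> \<in> ball (of_real l0) r \<Longrightarrow> F (0, \<mu>) = c"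
          by (auto simp: constant_on_def)
        have "F (0, of_real l0) = 0"
          using roots[of 0 "of_real l0"] root0 r by simp
        then have F0: "F (0, \<mu>) = 0" if "\<mu> \<in> ball (of_real l0) r" for \<mu>
          using c[OF that] c[of "of_real l0"] r by simp
        obtain l where l: "\<bar>l - l0\<bar> < r" "l \<notin> A_roots n"
          using iso r by blast
        have "complex_of_real l \<in> ball (of_real l0) r"
          using l(1) by (simp add: dist_norm norm_minus_commute flip: of_real_diff)
        then have "complex_of_real l \<in> T_roots 0 n"
          using roots F0 r by simp
        then show False
          using l(2) by (simp add: A_roots_iff_T_roots)
      qed
      show "uniform_limit K (\<lambda>j \<mu>. F (\<delta> j, \<mu>)) (\<lambda>\<mu>. F (0, \<mu>)) sequentially"
        if K: "compact K" "K \<subseteq> ball (of_real l0) r" for K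
      proof (rule uniform_limitI)
        fix e :: real
        assume "e > 0"
        have "continuous_on (ball 0 r \<times> K) F"
          using K by (intro continuous_on_subset[OF Fcont]) auto
        then obtain X where X: "0 \<in> X" "open X"
          "\<forall>\<delta>\<in>X \<inter> ball 0 r. \<forall>\<mu>\<in>K. dist (F (\<delta>, \<mu>)) (F (0, \<mu>)) \<le> e / 2"
          by (rule continuous_on_prod_compactE[where C = K and e = "e / 2" and ?x0.0 = 0])
            (use r K \<open>e > 0\<close> in auto)
        have "\<forall>\<^sub>F j in sequentially. \<delta> j \<in> X"
          using \<delta>0 X by (auto simp: tendsto_def)
        then show "\<forall>\<^sub>F j in sequentially. \<forall>\<mu>\<in>K. dist (F (\<delta> j, \<mu>)) (F (0, \<mu>)) < e"
        proof eventually_elim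
          case (elim j)
          then have "\<forall>\<mu>\<in>K. dist (F (\<delta> j, \<mu>)) (F (0, \<mu>)) \<le> e / 2"
            using X(3) \<delta>r[of j] by auto
          then show ?case
            using \<open>e > 0\<close> by fastforce
        qed
      qed
    qed (use r in auto)
    then show False
      using roots[of 0 "of_real l0"] root0 r by simp
  qed
qed

section \<open>Rearranging the perturbed roots\<close>

text \<open>The complements of \<open>S\<close> and of its image are both countably infinite.\<close>

lemma bij_extends_finite_inj:
  fixes h :: "'a::countable \<Rightarrow> 'a"
  assumes "infinite (UNIV :: 'a set)" "finite S" "inj_on h S"
  obtains \<sigma> where "bij \<sigma>" "\<And>m. m \<in> S \<Longrightarrow> \<sigma> m = h m"
proof -
  have "infinite (- S)" "infinite (- h ` S)"
    using assms(1,2) by (simp_all add: Compl_eq_Diff_UNIV)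
  then have "bij_betw (to_nat_on (- S)) (- S) UNIV" "bij_betw (to_nat_on (- h ` S)) (- h ` S) UNIV"
    by (auto intro: to_nat_on_infinite)
  then obtain g where g: "bij_betw g (- S) (- h ` S)"
    using bij_betw_trans[OF _ bij_betw_inv_into] by blast
  have "bij (\<lambda>m. if m \<in> S then h m else g m)"
  proof -
    have "bij_betw (\<lambda>m. if m \<in> S then h m else g m) (S \<union> - S) (h ` S \<union> - h ` S)"
      using bij_betw_disjoint_Un[OF inj_on_imp_bij_betw[OF assms(3)] g] by blast
    then show ?thesis by simp
  qed
  then show thesis
    by (rule that) simp
qed

text \<open>An almost nearest point of \<open>R d\<close> is chosen. The infimum of the distances need not be attained, so
the tolerance \<open>norm d\<close>, which tends to 0, is added.\<close>

lemma approximating_selection: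
  fixes R :: "'a::real_normed_vector \<Rightarrow> 'b::metric_space set"
  assumes ne: "\<And>d. d \<in> D \<Longrightarrow> R d \<noteq> {}"
    and D: "\<forall>\<^sub>F d in at 0. d \<in> D"
    and near: "\<And>e. e > 0 \<Longrightarrow> \<forall>\<^sub>F d in at 0. \<exists>l\<in>R d. dist l x < e"
  shows "\<exists>\<rho>. (\<forall>d\<in>D. \<rho> d \<in> R d) \<and> (\<rho> \<longlongrightarrow> x) (at 0)"
proof -
  have "\<exists>l. l \<in> R d \<and> (d \<noteq> 0 \<longrightarrow> dist l x < infdist x (R d) + norm d)" if "d \<in> D" for d
  proof (cases "d = 0")
    case False
    then have "(INF l\<in>R d. dist x l) < infdist x (R d) + norm d"
      using ne[OF that] by (simp add: infdist_notempty)
    then show ?thesis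
      using cINF_less_iff[OF ne[OF that] bdd_below_image_dist, of x] by (auto simp: dist_commute)
  qed (use ne[OF that] in auto)
  then obtain \<rho> where \<rho>: "\<And>d. d \<in> D \<Longrightarrow> \<rho> d \<in> R d"
    and *: "\<And>d. d \<in> D \<Longrightarrow> d \<noteq> 0 \<Longrightarrow> dist (\<rho> d) x < infdist x (R d) + norm d"
    by metis
  show ?thesis
  proof (intro exI conjI ballI)
    show "\<rho> d \<in> R d" if "d \<in> D" for d
      by (rule \<rho>[OF that])
    show "(\<rho> \<longlongrightarrow> x) (at 0)"
    proof (rule tendstoI)
      fix e :: real
      assume "e > 0"
      have "\<forall>\<^sub>F d in at (0::'a). norm d < e / 2"
        using \<open>e > 0\<close> by (auto simp: eventually_at dist_norm intro!: exI[of _ "e / 2"])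
      moreover have "\<forall>\<^sub>F d in at 0. \<exists>l\<in>R d. dist l x < e / 2"
        using \<open>e > 0\<close> by (intro near) simp
      moreover have "\<forall>\<^sub>F d in at (0::'a). d \<noteq> 0"
        by (simp add: eventually_at_filter)
      ultimately show "\<forall>\<^sub>F d in at 0. dist (\<rho> d) x < e"
        using D
      proof eventually_elim
        case (elim d)
        then obtain l where "l \<in> R d" "dist l x < e / 2"
          by auto
        then have "infdist x (R d) < e / 2"
          using infdist_le[of l "R d" x] by (simp add: dist_commute)
        then show ?case
          using *[of d] elim by linarith
      qed
    qed
  qed
qed

text \<open>For every \<open>m\<close> there is a selection \<open>\<rho> m \<delta>\<close> of points of \<open>R \<delta>\<close> that tends to \<open>lam m\<close>, but for fixed
\<open>\<delta>\<close> these selections may collide, since how small \<open>\<delta>\<close> must be depends on \<open>m\<close>. They cannot collide as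
long as they stay within disjoint discs about the points \<open>lam m\<close>. So for each \<open>\<delta>\<close> only the finitely
many \<open>m\<close> with \<open>\<bar>m\<bar> \<le> 1 / \<bar>\<delta>\<bar>\<close> and \<open>\<rho> m \<delta>\<close> in its disc are assigned \<open>\<rho> m \<delta>\<close>; the other indices
are matched with the remaining points in any way, which is possible because only finitely many are
fixed. Every fixed \<open>m\<close> is among the assigned indices when \<open>\<delta>\<close> is small enough, so the limits
are not affected.\<close>

lemma rearrangement_converges:
  fixes R :: "complex \<Rightarrow> complex set" and \<mu> :: "complex \<Rightarrow> int \<Rightarrow> complex"
  assumes lam: "strict_mono lam"
    and D: "\<forall>\<^sub>F \<delta> in at 0. \<delta> \<in> D"
    and \<mu>: "\<And>\<delta>. \<delta> \<in> D \<Longrightarrow> bij_betw (\<mu> \<delta>) UNIV (R \<delta>)"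
    and near: "\<And>m e. e > 0 \<Longrightarrow> \<forall>\<^sub>F \<delta> in at 0. \<exists>l\<in>R \<delta>. dist l (of_real (lam m)) < e"
  obtains \<sigma> :: "complex \<Rightarrow> int \<Rightarrow> int" where "\<And>\<delta>. \<delta> \<in> D \<Longrightarrow> bij (\<sigma> \<delta>)"
    "\<And>m. ((\<lambda>\<delta>. \<mu> \<delta> (\<sigma> \<delta> m)) \<longlongrightarrow> of_real (lam m)) (at 0)"
proof -
  have ne: "R \<delta> \<noteq> {}" if "\<delta> \<in> D" for \<delta>
    using \<mu>[OF that] by (auto simp: bij_betw_def)
  have "\<exists>\<rho>. (\<forall>\<delta>\<in>D. \<rho> \<delta> \<in> R \<delta>) \<and> (\<rho> \<longlongrightarrow> of_real (lam m)) (at 0)" for m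
    by (rule approximating_selection[OF ne D near])
  then obtain \<rho> where \<rho>: "\<And>m \<delta>. \<delta> \<in> D \<Longrightarrow> \<rho> m \<delta> \<in> R \<delta>"
    and lim: "\<And>m. (\<rho> m \<longlongrightarrow> of_real (lam m)) (at 0)"
    by metis
  \<comment> \<open>The discs of radius \<open>r m\<close> about \<open>lam m\<close> are pairwise disjoint.\<close>
  define r where "r = (\<lambda>m. min (lam (m + 1) - lam m) (lam m - lam (m - 1)) / 2)"
  have r_pos: "r m > 0" for m
    using strict_monoD[OF lam, of m "m + 1"] strict_monoD[OF lam, of "m - 1" m] by (simp add: r_def)
  have sep: "r i + r j \<le> lam j - lam i" if "i < j" for i j
  proof -
    have "lam (i + 1) \<le> lam j" "lam i \<le> lam (j - 1)"
      using that by (simp_all add: strict_mono_less_eq[OF lam])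
    then show ?thesis
      by (simp add: r_def min_def) (auto simp: field_simps)
  qed
  define S where "S = (\<lambda>\<delta>. {m::int. \<bar>real_of_int m\<bar> \<le> 1 / cmod \<delta> \<and> dist (\<rho> m \<delta>) (of_real (lam m)) < r m})"
  have fin: "finite (S \<delta>)" for \<delta>
  proof (rule finite_subset)
    show "S \<delta> \<subseteq> {- \<lceil>1 / cmod \<delta>\<rceil> .. \<lceil>1 / cmod \<delta>\<rceil>}"
    proof
      fix m
      assume "m \<in> S \<delta>"
      then have "\<bar>real_of_int m\<bar> \<le> 1 / cmod \<delta>"
        by (simp add: S_def)
      then show "m \<in> {- \<lceil>1 / cmod \<delta>\<rceil> .. \<lceil>1 / cmod \<delta>\<rceil>}"
        unfolding atLeastAtMost_iff by linarith
    qed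
  qed simp
  have ne_roots: "\<rho> i \<delta> \<noteq> \<rho> j \<delta>" if "i \<in> S \<delta>" "j \<in> S \<delta>" "i < j" for i j \<delta>
  proof
    assume "\<rho> i \<delta> = \<rho> j \<delta>"
    then have "dist (complex_of_real (lam i)) (of_real (lam j)) < r i + r j"
      using that dist_triangle2[of "complex_of_real (lam i)" "of_real (lam j)" "\<rho> i \<delta>"]
      by (auto simp: S_def dist_commute)
    then show False
      using sep[OF that(3)] by (simp add: dist_norm flip: of_real_diff)
  qed
  define h where "h = (\<lambda>\<delta> m. inv_into UNIV (\<mu> \<delta>) (\<rho> m \<delta>))"
  have \<mu>h: "\<mu> \<delta> (h \<delta> m) = \<rho> m \<delta>" if "\<delta> \<in> D" for \<delta> m
    using \<mu>[OF that] \<rho>[OF that] by (auto simp: h_def bij_betw_def f_inv_into_f)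
  have inj: "inj_on (h \<delta>) (S \<delta>)" if "\<delta> \<in> D" for \<delta>
  proof (rule linorder_inj_onI')
    show "h \<delta> i \<noteq> h \<delta> j" if "i \<in> S \<delta>" "j \<in> S \<delta>" "i < j" for i j
      using ne_roots[OF that] \<mu>h[OF \<open>\<delta> \<in> D\<close>] by metis
  qed
  have "\<exists>\<tau>. bij \<tau> \<and> (\<forall>m\<in>S \<delta>. \<tau> m = h \<delta> m)" if "\<delta> \<in> D" for \<delta>
    using bij_extends_finite_inj[OF infinite_UNIV_int fin inj[OF that]] by metis
  then obtain \<sigma> where \<sigma>: "\<And>\<delta>. \<delta> \<in> D \<Longrightarrow> bij (\<sigma> \<delta>)" "\<And>\<delta> m. \<delta> \<in> D \<Longrightarrow> m \<in> S \<delta> \<Longrightarrow> \<sigma> \<delta> m = h \<delta> m"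
    by metis
  show thesis
  proof (rule that[of \<sigma>])
    show "((\<lambda>\<delta>. \<mu> \<delta> (\<sigma> \<delta> m)) \<longlongrightarrow> of_real (lam m)) (at 0)" for m
    proof (rule Lim_transform_eventually[OF lim[of m]])
      have "filterlim (\<lambda>\<delta>. inverse (cmod \<delta>)) at_top (at 0)"
        by (intro filterlim_inverse_at_top tendsto_norm_zero tendsto_ident_at)
           (simp add: eventually_at_filter)
      then have "\<forall>\<^sub>F \<delta> in at 0. \<bar>real_of_int m\<bar> \<le> 1 / cmod \<delta>"
        by (simp add: filterlim_at_top inverse_eq_divide)
      moreover have "\<forall>\<^sub>F \<delta> in at 0. dist (\<rho> m \<delta>) (of_real (lam m)) < r m"
        using lim r_pos by (rule tendstoD)
      ultimately show "\<forall>\<^sub>F \<delta> in at 0. \<rho> m \<delta> = \<mu> \<delta> (\<sigma> \<delta> m)"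
        using D
      proof eventually_elim
        case (elim \<delta>)
        then have "m \<in> S \<delta>"
          by (simp add: S_def)
        then show ?case
          using \<sigma>(2) \<mu>h elim by simp
      qed
    qed
  qed (rule \<sigma>(1))
qed

section \<open>Norms\<close>

lemma L2_norm_cmult: "L2_norm S (\<lambda>x. c * f x) = cmod c * L2_norm S f"
  by (simp add: L2_norm_def norm_mult power_mult_distrib real_sqrt_mult)

lemma L2_norm_eq_integral:
  fixes f :: "real \<Rightarrow> complex"
  assumes "continuous_on {-1..1} f"
  shows "L2_norm {-1<..<1} f = sqrt (integral {-1..1} (\<lambda>x. (cmod (f x))\<^sup>2))"
proof -
  have "(\<lambda>x. (cmod (f x))\<^sup>2) absolutely_integrable_on {-1<..<1}"
    by (subst absolutely_integrable_on_Icc_iff_Ioo[symmetric])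
       (intro absolutely_integrable_continuous_real continuous_intros assms)
  then have "integrable (lebesgue_on {-1<..<1}) (\<lambda>x. (cmod (f x))\<^sup>2)"
    by (simp add: set_integrable_def integrable_restrict_space)
  then show ?thesis
    by (simp add: L2_norm_def lebesgue_integral_eq_integral integral_open_interval_real)
qed

lemma L2_norm_pos:
  fixes f :: "real \<Rightarrow> complex"
  assumes "continuous_on {-1..1} f" "x \<in> {-1..1}" "f x \<noteq> 0"
  shows "L2_norm {-1<..<1} f > 0"
proof -
  have cont: "continuous_on {-1..1} (\<lambda>x. (cmod (f x))\<^sup>2)"
    by (intro continuous_intros assms)
  have "integral {-1..1} (\<lambda>x. (cmod (f x))\<^sup>2) \<noteq> 0"
    using assms(2,3) by (subst integral_eq_0_iff[OF cont]) auto
  moreover have "integral {-1..1} (\<lambda>x. (cmod (f x))\<^sup>2) \<ge> 0"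
    by (intro integral_nonneg integrable_continuous_real cont) auto
  ultimately show ?thesis
    by (simp add: L2_norm_eq_integral[OF assms(1)])
qed

text \<open>The essential supremum over a null space would be \<open>-\<infinity>\<close>, but the rectangle has positive measure.\<close>

lemma Linf_norm_nonneg: "Linf_norm Omega f \<ge> 0"
proof (rule ccontr)
  assume *: "\<not> ?thesis"
  have "AE p in lebesgue_on Omega. ereal (cmod (f p)) \<le> Linf_norm Omega f"
    unfolding Linf_norm_def by (rule esssup_AE)
  then have "AE p in lebesgue_on Omega. False"
  proof eventually_elim
    case (elim p)
    then show ?case
      using * by (metis ereal_less_eq(5) norm_ge_zero order_trans)
  qed
  then have "emeasure (lebesgue_on Omega) (space (lebesgue_on Omega)) = 0"
    by (metis ae_filter_eq_bot_iff eventually_False)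
  moreover have "open Omega"
    unfolding Omega_def by (intro open_Times) auto
  then have "Omega \<in> sets lebesgue"
    by auto
  ultimately have "emeasure lebesgue Omega = 0"
    by (simp add: emeasure_restrict_space)
  then have "negligible Omega"
    using \<open>Omega \<in> sets lebesgue\<close> by (simp add: negligible_iff_null_sets null_setsI)
  moreover have "(0, 1 / 2) \<in> Omega"
    by (simp add: Omega_def)
  ultimately show False
    using open_not_negligible[OF \<open>open Omega\<close>] by blast
qed

lemma Linf_norm_le:
  fixes h :: "real \<Rightarrow> complex"
  assumes cont: "continuous_on UNIV h" and le: "\<And>x. x \<in> {-1..1} \<Longrightarrow> cmod (h x) \<le> e"
  shows "Linf_norm Omega (\<lambda>(x, y). h x) \<le> ereal e"
proof -
  have "continuous_on UNIV (\<lambda>p :: real \<times> real. ereal (cmod (h (fst p))))"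
    by (intro continuous_intros continuous_on_compose2[OF cont]) auto
  then have "(\<lambda>p :: real \<times> real. ereal (cmod (h (fst p)))) \<in> borel_measurable borel"
    by (rule borel_measurable_continuous_onI)
  then have "(\<lambda>p :: real \<times> real. ereal (cmod (h (fst p)))) \<in> borel_measurable (lebesgue_on Omega)"
    by (intro measurable_restrict_space1 measurable_completion) simp
  then show ?thesis
    unfolding Linf_norm_def case_prod_beta'
    by (rule esssup_I) (auto intro!: AE_I2 le simp: Omega_def)
qed

section \<open>Normalized profiles\<close>

text \<open>The profile scaled to have the value 1 at the interface \<open>x = 0\<close>. If \<open>sinh p\<close> and
\<open>sin q\<close> are non-zero, on either side of the interface one of the two factors is 1, so \<open>max\<close> and \<open>min\<close> replace the case distinction and make continuity
evident. The function is even in \<open>p\<close> and in \<open>q\<close>, so that it depends on the squares only.\<close>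

definition interface_profile :: "complex \<Rightarrow> complex \<Rightarrow> real \<Rightarrow> complex" where
  "interface_profile p q x =
     sin (q * of_real (1 - max x 0)) / sin q * (sinh (p * of_real (1 + min x 0)) / sinh p)"

text \<open>The member of norm 1 of the complex line of profiles that is positive at the interface.\<close>

definition normalized_profile :: "complex \<Rightarrow> complex \<Rightarrow> real \<Rightarrow> complex" where
  "normalized_profile p q x =
     interface_profile p q x / of_real (L2_norm {-1<..<1} (interface_profile p q))"

lemma interface_profile_minus:
  "interface_profile (- p) q = interface_profile p q"
  "interface_profile p (- q) = interface_profile p q"
  by (simp_all add: interface_profile_def fun_eq_iff)

lemma normalized_profile_minus:
  "normalized_profile (- p) q = normalized_profile p q"
  "normalized_profile p (- q) = normalized_profile p q"
  by (simp_all add: normalized_profile_def interface_profile_minus fun_eq_iff)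

lemma profile_eq_interface_profile:
  assumes "sinh (csqrt z) \<noteq> 0" "sin (csqrt w) \<noteq> 0"
  shows "profile N z w x =
    N * sinh (csqrt z) * sin (csqrt w) * interface_profile (csqrt z) (csqrt w) x"
  using assms by (auto simp: profile_def interface_profile_def)

text \<open>The parameters for which the profile does not vanish at the interface.\<close>

definition nonresonant :: "(complex \<times> complex) set" where
  "nonresonant = {(p, q). sinh p \<noteq> 0 \<and> sin q \<noteq> 0}"

lemma continuous_on_interface_profile:
  "continuous_on (nonresonant \<times> T) (\<lambda>(d, x). interface_profile (fst d) (snd d) x)"
  unfolding interface_profile_def case_prod_beta
  by (intro continuous_intros) (auto simp: nonresonant_def)

lemma continuous_on_interface_profile_snd:
  assumes "sinh p \<noteq> 0" "sin q \<noteq> 0"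
  shows "continuous_on T (interface_profile p q)"
  unfolding interface_profile_def by (intro continuous_intros) (use assms in auto)

lemma interface_profile_0:
  assumes "sinh p \<noteq> 0" "sin q \<noteq> 0"
  shows "interface_profile p q 0 = 1"
  using assms by (simp add: interface_profile_def)

lemma L2_norm_interface_profile_pos:
  assumes "sinh p \<noteq> 0" "sin q \<noteq> 0"
  shows "L2_norm {-1<..<1} (interface_profile p q) > 0"
  using assms
  by (intro L2_norm_pos[of _ 0] continuous_on_interface_profile_snd) (auto simp: interface_profile_0)

lemma L2_norm_normalized_profile:
  assumes "sinh p \<noteq> 0" "sin q \<noteq> 0"
  shows "L2_norm {-1<..<1} (normalized_profile p q) = 1"
proof -
  have "L2_norm {-1<..<1} (normalized_profile p q) =
      L2_norm {-1<..<1} (\<lambda>x. (1 / of_real (L2_norm {-1<..<1} (interface_profile p q))) * interface_profile p q x)"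
    by (rule arg_cong[where f = "L2_norm _"]) (simp add: normalized_profile_def fun_eq_iff)
  then show ?thesis
    using L2_norm_interface_profile_pos[OF assms] by (simp only: L2_norm_cmult) (simp add: norm_divide)
qed

text \<open>The norm depends continuously on the parameters as the root of a parametric integral.\<close>

lemma continuous_on_normalized_profile:
  "continuous_on (nonresonant \<times> {-1..1}) (\<lambda>(d, x). normalized_profile (fst d) (snd d) x)"
proof -
  have "continuous_on (nonresonant \<times> cbox (-1) 1) (\<lambda>(d, x). (cmod (interface_profile (fst d) (snd d) x))\<^sup>2)"
    using continuous_on_interface_profile[of "cbox (-1) 1"]
    unfolding case_prod_beta by (intro continuous_intros)
  then have "continuous_on nonresonant
      (\<lambda>d. integral {-1..1} (\<lambda>x. (cmod (interface_profile (fst d) (snd d) x))\<^sup>2))"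
    using integral_continuous_on_param by fastforce
  then have "continuous_on nonresonant
      (\<lambda>d. sqrt (integral {-1..1} (\<lambda>x. (cmod (interface_profile (fst d) (snd d) x))\<^sup>2)))"
    by (intro continuous_intros)
  then have M: "continuous_on nonresonant (\<lambda>d. L2_norm {-1<..<1} (interface_profile (fst d) (snd d)))"
    by (rule continuous_on_eq)
       (auto simp: nonresonant_def L2_norm_eq_integral continuous_on_interface_profile_snd)
  show ?thesis
    using continuous_on_interface_profile[of "{-1..1}"]
    unfolding normalized_profile_def case_prod_beta
    by (intro continuous_intros continuous_on_compose2[OF M])
       (use L2_norm_interface_profile_pos in \<open>auto simp: nonresonant_def less_imp_neq[symmetric]\<close>)
qed

text \<open>Joint continuity in the parameters and in \<open>x\<close> gives uniformity over the compact interval.\<close>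

lemma normalized_profile_uniform_limit:
  assumes lim: "(p \<longlongrightarrow> p0) F" "(q \<longlongrightarrow> q0) F" and nz: "sinh p0 \<noteq> 0" "sin q0 \<noteq> 0"
    and "e > 0"
  shows "\<forall>\<^sub>F t in F. \<forall>x\<in>{-1..1}. cmod (normalized_profile (p t) (q t) x - normalized_profile p0 q0 x) \<le> e"
proof -
  obtain X where X: "(p0, q0) \<in> X" "open X"
    "\<forall>d\<in>X \<inter> nonresonant. \<forall>x\<in>{-1..1}. dist (normalized_profile (fst d) (snd d) x)
       (normalized_profile (fst (p0, q0)) (snd (p0, q0)) x) \<le> e"
    using continuous_on_prod_compactE[OF continuous_on_normalized_profile, of "(p0, q0)" e] nz \<open>e > 0\<close>
    by (auto simp: nonresonant_def)
  have "((\<lambda>t. (p t, q t)) \<longlongrightarrow> (p0, q0)) F"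
    by (intro tendsto_intros lim)
  then have "\<forall>\<^sub>F t in F. (p t, q t) \<in> X"
    using X by (auto simp: tendsto_def)
  moreover have "\<forall>\<^sub>F t in F. sinh (p t) \<noteq> 0"
    using tendsto_sinh[OF lim(1)] nz by (intro tendsto_imp_eventually_ne) auto
  moreover have "\<forall>\<^sub>F t in F. sin (q t) \<noteq> 0"
    using isCont_tendsto_compose[OF DERIV_isCont[OF DERIV_sin] lim(2)] nz(2)
    by (rule tendsto_imp_eventually_ne)
  ultimately show ?thesis
  proof eventually_elim
    case (elim t)
    then show ?case
      using X(3)[rule_format, of "(p t, q t)"] by (auto simp: nonresonant_def dist_norm)
  qed
qed

text \<open>The constant \<open>K\<close> removes both the norm of the profile and the phase of its value at the interface.
Hence a normalization is prescribed by the unimodular factor \<open>\<theta>\<close> alone, whatever square roots are used.\<close>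

lemma T_profile_eq_normalized_profile:
  assumes l: "l \<in> T_roots \<delta> n" and \<delta>: "cmod \<delta> < 1"
  shows "\<exists>K. K \<noteq> 0 \<and> (\<forall>\<theta> x. T_profile \<delta> n l (\<theta> * K) x =
      \<theta> * normalized_profile (csqrt ((1 + \<delta>) * l + of_real ((real n * pi)\<^sup>2)))
        (csqrt (l - of_real ((real n * pi)\<^sup>2))) x)"
proof -
  define z where "z = (1 + \<delta>) * l + of_real ((real n * pi)\<^sup>2)"
  define w where "w = l - of_real ((real n * pi)\<^sup>2)"
  have nz: "sinh (csqrt z) \<noteq> 0" "sin (csqrt w) \<noteq> 0"
    unfolding z_def w_def by (rule T_root_nonresonant[OF l \<delta>])+
  define K where "K = 1 / (of_real (L2_norm {-1<..<1} (interface_profile (csqrt z) (csqrt w))) * sinh (csqrt z) * sin (csqrt w))"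
  show ?thesis
  proof (intro exI conjI allI)
    show "K \<noteq> 0"
      using nz L2_norm_interface_profile_pos[OF nz] by (simp add: K_def)
    show "T_profile \<delta> n l (\<theta> * K) x =
      \<theta> * normalized_profile (csqrt ((1 + \<delta>) * l + of_real ((real n * pi)\<^sup>2)))
        (csqrt (l - of_real ((real n * pi)\<^sup>2))) x" for \<theta> x
      unfolding T_profile_def z_def[symmetric] w_def[symmetric]
      using nz profile_eq_interface_profile[OF nz]
      by (simp add: K_def normalized_profile_def)
  qed
qed

lemma continuous_on_profile: "continuous_on UNIV (profile N z w)"
proof -
  have "profile N z w = (\<lambda>x. N * sin (csqrt w * of_real (1 - max x 0)) * sinh (csqrt z * of_real (1 + min x 0)))"
    by (auto simp: profile_def fun_eq_iff)
  then show ?thesis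
    by (simp only:) (intro continuous_intros)
qed

lemma A_profile_eq_T_profile: "A_profile n l N = T_profile 0 n (of_real l) N"
  by (simp add: A_profile_def T_profile_def)

lemma A_profile_eq_normalized_profile:
  assumes l: "l \<in> A_roots n" and "L2_norm {-1<..<1} (A_profile n l N) = 1"
  shows "\<exists>\<theta>. cmod \<theta> = 1 \<and> (\<forall>x. A_profile n l N x =
      \<theta> * normalized_profile (csqrt (of_real l + of_real ((real n * pi)\<^sup>2)))
        (csqrt (of_real l - of_real ((real n * pi)\<^sup>2))) x)"
proof -
  have l': "complex_of_real l \<in> T_roots 0 n"
    using l by (simp add: A_roots_iff_T_roots)
  define E where "E = normalized_profile (csqrt (of_real l + of_real ((real n * pi)\<^sup>2)))
        (csqrt (of_real l - of_real ((real n * pi)\<^sup>2)))"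
  obtain K where K: "K \<noteq> 0" "\<And>\<theta> x. T_profile 0 n (of_real l) (\<theta> * K) x = \<theta> * E x"
    using T_profile_eq_normalized_profile[OF l'] unfolding E_def add_0_right mult_1
    by (metis norm_zero zero_less_one)
  have A: "A_profile n l N = (\<lambda>x. N / K * E x)"
  proof
    fix x
    have "A_profile n l N x = T_profile 0 n (of_real l) (N / K * K) x"
      using K(1) by (simp add: A_profile_eq_T_profile)
    also have "\<dots> = N / K * E x"
      by (rule K(2))
    finally show "A_profile n l N x = N / K * E x" .
  qed
  have "L2_norm {-1<..<1} E = 1"
    unfolding E_def
    using T_root_nonresonant[OF l'] by (intro L2_norm_normalized_profile) simp_all
  then have "cmod (N / K) = 1"
    using assms(2) unfolding A L2_norm_cmult by simp
  then show ?thesis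
    using A unfolding E_def by (intro exI[of _ "N / K"]) simp
qed

text \<open>Both profiles carry the same factor \<open>\<theta>\<close>, so their difference is \<open>\<theta>\<close> times a difference of normalized
profiles. These are even in the square roots, which can therefore be taken from branches that are
continuous at the limit point although \<open>csqrt\<close> may jump there.\<close>

lemma profile_difference_tendsto:
  fixes \<mu> :: "complex \<Rightarrow> complex"
  assumes l0: "l0 \<in> A_roots n"
    and lim: "(\<mu> \<longlongrightarrow> of_real l0) (at 0)"
    and A: "\<And>x. A_profile n l0 N0 x =
        \<theta> * normalized_profile (csqrt (of_real l0 + of_real ((real n * pi)\<^sup>2)))
        (csqrt (of_real l0 - of_real ((real n * pi)\<^sup>2))) x" "cmod \<theta> = 1"
    and T: "\<forall>\<^sub>F \<delta> in at 0. \<forall>x. T_profile \<delta> n (\<mu> \<delta>) (N \<delta>) x =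
        \<theta> * normalized_profile (csqrt ((1 + \<delta>) * \<mu> \<delta> + of_real ((real n * pi)\<^sup>2)))
        (csqrt (\<mu> \<delta> - of_real ((real n * pi)\<^sup>2))) x"
  shows "((\<lambda>\<delta>. Linf_norm Omega (\<lambda>(x, y). T_profile \<delta> n (\<mu> \<delta>) (N \<delta>) x - A_profile n l0 N0 x))
      \<longlongrightarrow> 0) (at 0)"
proof -
  define k where "k = complex_of_real ((real n * pi)\<^sup>2)"
  define z where "z = (\<lambda>\<delta>. (1 + \<delta>) * \<mu> \<delta> + k)"
  define w where "w = (\<lambda>\<delta>. \<mu> \<delta> - k)"
  define z0 where "z0 = of_real l0 + k"
  define w0 where "w0 = of_real l0 - k"
  have l0': "complex_of_real l0 \<in> T_roots 0 n"
    using l0 by (simp add: A_roots_iff_T_roots)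
  have nz: "sinh (csqrt z0) \<noteq> 0" "sin (csqrt w0) \<noteq> 0"
    using T_root_nonresonant[OF l0'] by (simp_all add: z0_def w0_def k_def)
  then have nz': "z0 \<noteq> 0" "w0 \<noteq> 0"
    by auto
  define p where "p = (\<lambda>\<delta>. sqrt_branch z0 (z \<delta>))"
  define q where "q = (\<lambda>\<delta>. sqrt_branch w0 (w \<delta>))"
  have branch: "normalized_profile (csqrt (z \<delta>)) (csqrt (w \<delta>)) = normalized_profile (p \<delta>) (q \<delta>)" for \<delta>
    using csqrt_cases[of "p \<delta>"] csqrt_cases[of "q \<delta>"] nz'
    by (auto simp: p_def q_def sqrt_branch_square normalized_profile_minus)
  have "(z \<longlongrightarrow> (1 + 0) * of_real l0 + k) (at 0)" "(w \<longlongrightarrow> w0) (at 0)"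
    unfolding z_def w_def w0_def by (intro tendsto_intros lim)+
  then have plim: "(p \<longlongrightarrow> csqrt z0) (at 0)" and qlim: "(q \<longlongrightarrow> csqrt w0) (at 0)"
    unfolding p_def q_def using nz' by (auto intro!: tendsto_sqrt_branch simp: z0_def)
  have small: "\<forall>\<^sub>F \<delta> in at 0. Linf_norm Omega (\<lambda>(x, y). T_profile \<delta> n (\<mu> \<delta>) (N \<delta>) x - A_profile n l0 N0 x) \<le> ereal e"
    if "e > 0" for e
    using T normalized_profile_uniform_limit[OF plim qlim nz that]
  proof eventually_elim
    case (elim \<delta>)
    have "T_profile \<delta> n (\<mu> \<delta>) (N \<delta>) x - A_profile n l0 N0 x =
        \<theta> * (normalized_profile (p \<delta>) (q \<delta>) x - normalized_profile (csqrt z0) (csqrt w0) x)" for x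
      using elim(1) branch[of \<delta>]
      by (simp add: A z_def w_def z0_def w0_def k_def right_diff_distrib)
    moreover have "continuous_on UNIV (\<lambda>x. T_profile \<delta> n (\<mu> \<delta>) (N \<delta>) x - A_profile n l0 N0 x)"
      unfolding T_profile_def A_profile_def
      by (intro continuous_on_diff continuous_on_profile)
    ultimately show ?case
      using elim(2) A(2) by (intro Linf_norm_le) (simp_all add: norm_mult)
  qed
  show ?thesis
  proof (rule order_tendstoI)
    fix a :: ereal
    assume "a < 0"
    then show "\<forall>\<^sub>F \<delta> in at 0. a < Linf_norm Omega (\<lambda>(x, y). T_profile \<delta> n (\<mu> \<delta>) (N \<delta>) x - A_profile n l0 N0 x)"
      by (intro always_eventually allI less_le_trans[OF _ Linf_norm_nonneg])
  next
    fix a :: ereal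
    assume "0 < a"
    then obtain e where e: "0 < ereal e" "ereal e < a"
      using ereal_dense2 by blast
    then have "e > 0"
      by simp
    then show "\<forall>\<^sub>F \<delta> in at 0. Linf_norm Omega (\<lambda>(x, y). T_profile \<delta> n (\<mu> \<delta>) (N \<delta>) x - A_profile n l0 N0 x) < a"
      by (rule eventually_mono[OF small le_less_trans[OF _ e(2)]])
  qed
qed

section \<open>Convergence of eigenvalues and profiles\<close>

theorem theorem5p3:
  fixes c :: real
    and lam :: "nat \<Rightarrow> int \<Rightarrow> real"
    and N :: "nat \<Rightarrow> int \<Rightarrow> complex"
    and mu :: "complex \<Rightarrow> nat \<Rightarrow> int \<Rightarrow> complex"
  assumes c: "0 < c" "c < 1"
    and lam_increasing: "\<And>n. n \<ge> 1 \<Longrightarrow> strict_mono (lam n)"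
    and lam_roots: "\<And>n. n \<ge> 1 \<Longrightarrow> range (lam n) = A_roots n"
    and lam_zero: "\<And>n. n \<ge> 1 \<Longrightarrow> lam n 0 = 0"
    and N_nonzero: "\<And>n m. n \<ge> 1 \<Longrightarrow> N n m \<noteq> 0"
    and N_normalized: "\<And>n m. n \<ge> 1 \<Longrightarrow> L2_norm {-1<..<1} (A_profile n (lam n m) (N n m)) = 1"
    and mu_roots: "\<And>\<delta> n. cmod \<delta> \<le> c \<Longrightarrow> n \<ge> 1 \<Longrightarrow> bij_betw (mu \<delta> n) UNIV (T_roots \<delta> n)"
    and mu_spectrum: "\<And>\<delta>. cmod \<delta> \<le> c \<Longrightarrow> T_point_spectrum \<delta> = (\<Union>n\<in>{1..}. \<Union>m. {mu \<delta> n m})"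
  shows "\<forall>n\<ge>1. \<exists>(\<sigma> :: complex \<Rightarrow> int \<Rightarrow> int) (N' :: complex \<Rightarrow> int \<Rightarrow> complex).
    (\<forall>\<delta>. cmod \<delta> \<le> c \<longrightarrow> bij (\<sigma> \<delta>)) \<and>
    (\<forall>\<delta> m. cmod \<delta> \<le> c \<longrightarrow> N' \<delta> m \<noteq> 0 \<and>
       L2_norm {-1<..<1} (T_profile \<delta> n (mu \<delta> n (\<sigma> \<delta> m)) (N' \<delta> m)) = 1) \<and>
    (\<forall>m. ((\<lambda>\<delta>. cmod (mu \<delta> n (\<sigma> \<delta> m) - of_real (lam n m))) \<longlongrightarrow> 0) (at 0) \<and>
       ((\<lambda>\<delta>. Linf_norm Omega
          (\<lambda>(x, y). T_profile \<delta> n (mu \<delta> n (\<sigma> \<delta> m)) (N' \<delta> m) x - A_profile n (lam n m) (N n m) x))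
          \<longlongrightarrow> 0) (at 0))"
proof (intro allI impI)
  fix n :: nat
  assume n: "n \<ge> 1"
  define k where "k = complex_of_real ((real n * pi)\<^sup>2)"
  have root: "lam n m \<in> A_roots n" for m
    using lam_roots[OF n] by auto
  have small: "\<forall>\<^sub>F \<delta> in at 0. \<delta> \<in> {\<delta>. cmod \<delta> \<le> c}"
    using c by (auto simp: eventually_at dist_norm intro!: exI[of _ c])
  have near: "\<forall>\<^sub>F \<delta> in at 0. \<exists>l\<in>T_roots \<delta> n. dist l (of_real (lam n m)) < e" if "e > 0" for m e
  proof -
    \<comment> \<open>The gap between consecutive terms of the increasing sequence contains no root.\<close>
    have "\<exists>l. \<bar>l - lam n m\<bar> < d \<and> l \<notin> A_roots n" if "d > 0" for d
    proof -
      have gap: "lam n m < lam n (m + 1)"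
        using lam_increasing[OF n] by (simp add: strict_mono_less)
      then obtain l where l: "lam n m < l" "l < min (lam n (m + 1)) (lam n m + d)"
        using dense[of "lam n m" "min (lam n (m + 1)) (lam n m + d)"] \<open>d > 0\<close> by auto
      have "l \<noteq> lam n j" for j
        using l strict_mono_less[OF lam_increasing[OF n], of m j]
          strict_mono_less[OF lam_increasing[OF n], of j "m + 1"] by auto
      then have "l \<notin> A_roots n"
        using lam_roots[OF n] by auto
      then show ?thesis
        using l by (intro exI[of _ l]) auto
    qed
    then have "\<exists>\<eta>>0. \<forall>\<delta>. cmod \<delta> < \<eta> \<longrightarrow> (\<exists>l\<in>T_roots \<delta> n. cmod (l - of_real (lam n m)) < e)"
      using T_root_near_A_root[OF root _ \<open>e > 0\<close>] by blast
    then show ?thesis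
      by (auto simp: eventually_at dist_norm)
  qed
  obtain \<sigma> where \<sigma>: "\<And>\<delta>. \<delta> \<in> {\<delta>. cmod \<delta> \<le> c} \<Longrightarrow> bij (\<sigma> \<delta>)"
    and lim: "\<And>m. ((\<lambda>\<delta>. mu \<delta> n (\<sigma> \<delta> m)) \<longlongrightarrow> of_real (lam n m)) (at 0)"
    by (rule rearrangement_converges[of "lam n" "{\<delta>. cmod \<delta> \<le> c}" "\<lambda>\<delta>. mu \<delta> n" "\<lambda>\<delta>. T_roots \<delta> n"])
       (use lam_increasing[OF n] small mu_roots[OF _ n] near in auto)
  define E where "E = (\<lambda>\<delta> m. normalized_profile
     (csqrt ((1 + \<delta>) * mu \<delta> n (\<sigma> \<delta> m) + k)) (csqrt (mu \<delta> n (\<sigma> \<delta> m) - k)))"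
  have mu_in: "mu \<delta> n (\<sigma> \<delta> m) \<in> T_roots \<delta> n" if "cmod \<delta> \<le> c" for \<delta> m
    using mu_roots[OF that n] by (auto simp: bij_betw_def)
  \<comment> \<open>The unperturbed constant \<open>N n m\<close> fixes the phase, and the perturbed constants copy it.\<close>
  have "\<exists>\<theta>. cmod \<theta> = 1 \<and> (\<forall>x. A_profile n (lam n m) (N n m) x =
      \<theta> * normalized_profile (csqrt (of_real (lam n m) + k)) (csqrt (of_real (lam n m) - k)) x)" for m
    using A_profile_eq_normalized_profile[OF root N_normalized[OF n]] unfolding k_def .
  then obtain \<theta> where \<theta>: "\<And>m. cmod (\<theta> m) = 1" "\<And>m x. A_profile n (lam n m) (N n m) x =
      \<theta> m * normalized_profile (csqrt (of_real (lam n m) + k)) (csqrt (of_real (lam n m) - k)) x"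
    by metis
  have "\<exists>K. K \<noteq> 0 \<and> (\<forall>x. T_profile \<delta> n (mu \<delta> n (\<sigma> \<delta> m)) (\<theta> m * K) x = \<theta> m * E \<delta> m x)"
    if "cmod \<delta> \<le> c" for \<delta> m
  proof -
    have "cmod \<delta> < 1"
      using that c by simp
    then show ?thesis
      using T_profile_eq_normalized_profile[OF mu_in[OF that]] unfolding E_def k_def by blast
  qed
  then obtain K where K: "\<And>\<delta> m. cmod \<delta> \<le> c \<Longrightarrow> K \<delta> m \<noteq> 0"
    "\<And>\<delta> m x. cmod \<delta> \<le> c \<Longrightarrow> T_profile \<delta> n (mu \<delta> n (\<sigma> \<delta> m)) (\<theta> m * K \<delta> m) x = \<theta> m * E \<delta> m x"
    by metis
  have norm: "L2_norm {-1<..<1} (T_profile \<delta> n (mu \<delta> n (\<sigma> \<delta> m)) (\<theta> m * K \<delta> m)) = 1"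
    if "cmod \<delta> \<le> c" for \<delta> m
  proof -
    have "L2_norm {-1<..<1} (E \<delta> m) = 1"
      unfolding E_def k_def using that c
      by (intro L2_norm_normalized_profile T_root_nonresonant[OF mu_in[OF that]]) auto
    moreover have "T_profile \<delta> n (mu \<delta> n (\<sigma> \<delta> m)) (\<theta> m * K \<delta> m) = (\<lambda>x. \<theta> m * E \<delta> m x)"
      using K(2)[OF that] by auto
    ultimately show ?thesis
      by (simp add: L2_norm_cmult \<theta>(1))
  qed
  have profiles: "((\<lambda>\<delta>. Linf_norm Omega
      (\<lambda>(x, y). T_profile \<delta> n (mu \<delta> n (\<sigma> \<delta> m)) (\<theta> m * K \<delta> m) x - A_profile n (lam n m) (N n m) x))
      \<longlongrightarrow> 0) (at 0)" for m
  proof (rule profile_difference_tendsto[OF root lim _ \<theta>(1)[of m]])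
    show "\<forall>\<^sub>F \<delta> in at 0. \<forall>x. T_profile \<delta> n (mu \<delta> n (\<sigma> \<delta> m)) (\<theta> m * K \<delta> m) x =
       \<theta> m * normalized_profile (csqrt ((1 + \<delta>) * mu \<delta> n (\<sigma> \<delta> m) + of_real ((real n * pi)\<^sup>2)))
        (csqrt (mu \<delta> n (\<sigma> \<delta> m) - of_real ((real n * pi)\<^sup>2))) x"
      using small by eventually_elim (simp add: K(2) E_def k_def)
  qed (simp add: \<theta>(2) k_def)
  have "((\<lambda>\<delta>. cmod (mu \<delta> n (\<sigma> \<delta> m) - of_real (lam n m))) \<longlongrightarrow> 0) (at 0)" for m
    using lim[of m] by (simp add: LIM_zero_iff tendsto_norm_zero_iff)
  moreover have "\<theta> m * K \<delta> m \<noteq> 0" if "cmod \<delta> \<le> c" for \<delta> m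
    using K(1)[OF that] \<theta>(1)[of m] by auto
  ultimately show "\<exists>(\<sigma> :: complex \<Rightarrow> int \<Rightarrow> int) (N' :: complex \<Rightarrow> int \<Rightarrow> complex).
    (\<forall>\<delta>. cmod \<delta> \<le> c \<longrightarrow> bij (\<sigma> \<delta>)) \<and>
    (\<forall>\<delta> m. cmod \<delta> \<le> c \<longrightarrow> N' \<delta> m \<noteq> 0 \<and>
       L2_norm {-1<..<1} (T_profile \<delta> n (mu \<delta> n (\<sigma> \<delta> m)) (N' \<delta> m)) = 1) \<and>
    (\<forall>m. ((\<lambda>\<delta>. cmod (mu \<delta> n (\<sigma> \<delta> m) - of_real (lam n m))) \<longlongrightarrow> 0) (at 0) \<and>
       ((\<lambda>\<delta>. Linf_norm Omega
          (\<lambda>(x, y). T_profile \<delta> n (mu \<delta> n (\<sigma> \<delta> m)) (N' \<delta> m) x - A_profile n (lam n m) (N n m) x))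
          \<longlongrightarrow> 0) (at 0))"
    using \<sigma> norm profiles
    by (intro exI[of _ \<sigma>] exI[of _ "\<lambda>\<delta> m. \<theta> m * K \<delta> m"]) simp
qed

end
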